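(* Let $\mathcal D$ be a complex 2-dimensional foliation on a Kähler surface $(M,g,J)$ which is conformal and totally geodesic. Then the opposite almost Hermitian structure $I$ defined by $I|_{\mathcal D}=J|_{\mathcal D}$, $I|_{\mathcal D^\perp}=-J|_{\mathcal D^\perp}$ is Hermitian. Hence a conformal and totally geodesic complex foliation $\mathcal D$ is holomorphic.
   Context: A Kähler surface is a connected Kähler manifold $(M,g,J)$ of real dimension $4$, with Levi-Civita connection $\nabla$. A foliation is identified with the distribution $\mathcal D$ of vectors tangent to its leaves; dimension means real rank. $\mathcal D$ is complex if $J(\mathcal D)\subset\mathcal D$. The foliation $\mathcal D$ is conformal if there is a 1-form $\alpha$ vanishing on $\mathcal D^\perp$ such that $L_Vg=\alpha(V)g$ holds on $\mathcal D^\perp$ (i.e. when evaluated on pairs of vectors in $\mathcal D^\perp$) for every vector field $V$ tangent to $\mathcal D$. $\mathcal D$ is totally geodesic if $\nabla_XY\in\Gamma(\mathcal D)$ for all $X,Y\in\Gamma(\mathcal D)$. $\mathcal D$ is holomorphic if $(L_\xi J)(TM)\subset\mathcal D$ for every $\xi\in\Gamma(\mathcal D)$. An almost Hermitian structure $I$ is Hermitian if $I$ is an integrable almost complex structure. $L$ denotes the Lie derivative. *)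

theory Defs
  imports "HOL-Analysis.Analysis"
begin

section \<open>Smooth maps between Euclidean spaces\<close>

text \<open>Both notions are only used on open sets.\<close>

primrec Ck_on :: "nat \<Rightarrow> 'e::euclidean_space set \<Rightarrow> ('e \<Rightarrow> 'f::real_normed_vector) \<Rightarrow> bool" where
  "Ck_on 0 S f \<longleftrightarrow> continuous_on S f"
| "Ck_on (Suc k) S f \<longleftrightarrow>
     f differentiable_on S \<and> (\<forall>v. Ck_on k S (\<lambda>x. frechet_derivative f (at x) v))"

definition smooth_on :: "'e::euclidean_space set \<Rightarrow> ('e \<Rightarrow> 'f::real_normed_vector) \<Rightarrow> bool" where
  "smooth_on S f \<longleftrightarrow> (\<forall>k. Ck_on k S f)"


section \<open>Smooth manifolds\<close>

text \<open>
  The underlying space of the manifold is a Hausdorff second countable type \<open>'a\<close>, the model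
  space is the Euclidean space \<open>'e\<close>. A chart is a domain together with a coordinate map; values
  of the coordinate map outside the domain are irrelevant.
\<close>

type_synonym ('a, 'e) chart = "'a set \<times> ('a \<Rightarrow> 'e)"

definition chart_inv :: "('a, 'e) chart \<Rightarrow> 'e \<Rightarrow> 'a" where
  "chart_inv c = inv_into (fst c) (snd c)"

definition smooth_atlas ::
    "('a::{t2_space, second_countable_topology}, 'e::euclidean_space) chart set \<Rightarrow> bool" where
  "smooth_atlas A \<longleftrightarrow>
     (\<Union>c\<in>A. fst c) = UNIV \<and>
     (\<forall>c\<in>A. open (fst c) \<and> open (snd c ` fst c) \<and>
        homeomorphism (fst c) (snd c ` fst c) (snd c) (chart_inv c)) \<and>
     (\<forall>c\<in>A. \<forall>d\<in>A. smooth_on (snd c ` (fst c \<inter> fst d)) (snd d \<circ> chart_inv c))"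

text \<open>
  Every point \<open>p\<close> gets a preferred chart of the atlas. The tangent space at \<open>p\<close> is the model
  space \<open>'e\<close>, a vector being identified with its components in the preferred chart at \<open>p\<close>.
  Accordingly a (rough) vector field is a function \<open>'a \<Rightarrow> 'e\<close>, and \<open>in_chart A c p v\<close> are the
  components of the tangent vector \<open>v\<close> at \<open>p\<close> in the chart \<open>c\<close>, i.e. the differential at \<open>p\<close>
  of the coordinate map of \<open>c\<close> applied to \<open>v\<close>.
\<close>

definition chart_at :: "('a, 'e) chart set \<Rightarrow> 'a \<Rightarrow> ('a, 'e) chart" where
  "chart_at A p = (SOME c. c \<in> A \<and> p \<in> fst c)"

definition in_chart ::
    "('a, 'e::euclidean_space) chart set \<Rightarrow> ('a, 'e) chart \<Rightarrow> 'a \<Rightarrow> 'e \<Rightarrow> 'e" where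
  "in_chart A c p v =
     frechet_derivative (snd c \<circ> chart_inv (chart_at A p)) (at (snd (chart_at A p) p)) v"

definition local_rep ::
    "('a, 'e::euclidean_space) chart set \<Rightarrow> ('a, 'e) chart \<Rightarrow> ('a \<Rightarrow> 'e) \<Rightarrow> 'e \<Rightarrow> 'e" where
  "local_rep A c X x = in_chart A c (chart_inv c x) (X (chart_inv c x))"

definition smooth_fun_on ::
    "('a, 'e::euclidean_space) chart set \<Rightarrow> 'a set \<Rightarrow> ('a \<Rightarrow> real) \<Rightarrow> bool" where
  "smooth_fun_on A U f \<longleftrightarrow> (\<forall>c\<in>A. smooth_on (snd c ` (fst c \<inter> U)) (f \<circ> chart_inv c))"

definition smooth_field_on ::
    "('a, 'e::euclidean_space) chart set \<Rightarrow> 'a set \<Rightarrow> ('a \<Rightarrow> 'e) \<Rightarrow> bool" where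
  "smooth_field_on A U X \<longleftrightarrow> (\<forall>c\<in>A. smooth_on (snd c ` (fst c \<inter> U)) (local_rep A c X))"

definition smooth_funs :: "('a, 'e::euclidean_space) chart set \<Rightarrow> ('a \<Rightarrow> real) set" where
  "smooth_funs A = {f. smooth_fun_on A UNIV f}"

definition vector_fields :: "('a, 'e::euclidean_space) chart set \<Rightarrow> ('a \<Rightarrow> 'e) set" where
  "vector_fields A = {X. smooth_field_on A UNIV X}"

definition dir_deriv ::
    "('a, 'e::euclidean_space) chart set \<Rightarrow> ('a \<Rightarrow> 'e) \<Rightarrow> ('a \<Rightarrow> real) \<Rightarrow> 'a \<Rightarrow> real" where
  "dir_deriv A X f p =
     frechet_derivative (f \<circ> chart_inv (chart_at A p)) (at (snd (chart_at A p) p)) (X p)"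

text \<open>The coordinate formula \<open>[X, Y] = DY(X) - DX(Y)\<close>, evaluated in the preferred chart.\<close>

definition lie_bracket ::
    "('a, 'e::euclidean_space) chart set \<Rightarrow> ('a \<Rightarrow> 'e) \<Rightarrow> ('a \<Rightarrow> 'e) \<Rightarrow> 'a \<Rightarrow> 'e" where
  "lie_bracket A X Y p =
     (let c = chart_at A p in
        frechet_derivative (local_rep A c Y) (at (snd c p)) (X p)
      - frechet_derivative (local_rep A c X) (at (snd c p)) (Y p))"


section \<open>Tensor fields\<close>

text \<open>
  A tensor field is smooth if its values on local smooth vector fields are smooth; testing on
  coordinate fields, this says that its components in charts are smooth.
\<close>

definition one_form ::
    "('a::topological_space, 'e::euclidean_space) chart set \<Rightarrow> ('a \<Rightarrow> 'e \<Rightarrow> real) \<Rightarrow> bool" where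
  "one_form A \<alpha> \<longleftrightarrow>
     (\<forall>p. linear (\<alpha> p)) \<and>
     (\<forall>U X. open U \<and> smooth_field_on A U X \<longrightarrow> smooth_fun_on A U (\<lambda>p. \<alpha> p (X p)))"

definition riemannian_metric ::
    "('a::topological_space, 'e::euclidean_space) chart set \<Rightarrow> ('a \<Rightarrow> 'e \<Rightarrow> 'e \<Rightarrow> real) \<Rightarrow> bool" where
  "riemannian_metric A g \<longleftrightarrow>
     (\<forall>p. bilinear (g p) \<and> (\<forall>u v. g p u v = g p v u) \<and> (\<forall>u. u \<noteq> 0 \<longrightarrow> 0 < g p u u)) \<and>
     (\<forall>U X Y. open U \<and> smooth_field_on A U X \<and> smooth_field_on A U Y
        \<longrightarrow> smooth_fun_on A U (\<lambda>p. g p (X p) (Y p)))"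

definition endomorphism_field ::
    "('a::topological_space, 'e::euclidean_space) chart set \<Rightarrow> ('a \<Rightarrow> 'e \<Rightarrow> 'e) \<Rightarrow> bool" where
  "endomorphism_field A J \<longleftrightarrow>
     (\<forall>p. linear (J p)) \<and>
     (\<forall>U X. open U \<and> smooth_field_on A U X \<longrightarrow> smooth_field_on A U (\<lambda>p. J p (X p)))"

definition lie_metric ::
    "('a, 'e::euclidean_space) chart set \<Rightarrow> ('a \<Rightarrow> 'e \<Rightarrow> 'e \<Rightarrow> real) \<Rightarrow> ('a \<Rightarrow> 'e)
      \<Rightarrow> ('a \<Rightarrow> 'e) \<Rightarrow> ('a \<Rightarrow> 'e) \<Rightarrow> 'a \<Rightarrow> real" where
  "lie_metric A g V X Y p =
     dir_deriv A V (\<lambda>q. g q (X q) (Y q)) p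
     - g p (lie_bracket A V X p) (Y p) - g p (X p) (lie_bracket A V Y p)"

definition lie_endo ::
    "('a, 'e::euclidean_space) chart set \<Rightarrow> ('a \<Rightarrow> 'e \<Rightarrow> 'e) \<Rightarrow> ('a \<Rightarrow> 'e)
      \<Rightarrow> ('a \<Rightarrow> 'e) \<Rightarrow> 'a \<Rightarrow> 'e" where
  "lie_endo A J V X p = lie_bracket A V (\<lambda>q. J q (X q)) p - J p (lie_bracket A V X p)"

definition exterior_derivative2 ::
    "('a, 'e::euclidean_space) chart set \<Rightarrow> ('a \<Rightarrow> 'e \<Rightarrow> 'e \<Rightarrow> real)
      \<Rightarrow> ('a \<Rightarrow> 'e) \<Rightarrow> ('a \<Rightarrow> 'e) \<Rightarrow> ('a \<Rightarrow> 'e) \<Rightarrow> 'a \<Rightarrow> real" where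
  "exterior_derivative2 A \<omega> X Y Z p =
     dir_deriv A X (\<lambda>q. \<omega> q (Y q) (Z q)) p
     + dir_deriv A Y (\<lambda>q. \<omega> q (Z q) (X q)) p
     + dir_deriv A Z (\<lambda>q. \<omega> q (X q) (Y q)) p
     - \<omega> p (lie_bracket A X Y p) (Z p)
     - \<omega> p (lie_bracket A Y Z p) (X p)
     - \<omega> p (lie_bracket A Z X p) (Y p)"

definition levi_civita ::
    "('a, 'e::euclidean_space) chart set \<Rightarrow> ('a \<Rightarrow> 'e \<Rightarrow> 'e \<Rightarrow> real)
      \<Rightarrow> (('a \<Rightarrow> 'e) \<Rightarrow> ('a \<Rightarrow> 'e) \<Rightarrow> 'a \<Rightarrow> 'e) \<Rightarrow> bool" where
  "levi_civita A g nabla \<longleftrightarrow>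
     (\<forall>X\<in>vector_fields A. \<forall>Y\<in>vector_fields A.
        nabla X Y \<in> vector_fields A \<and>
        (\<forall>Z\<in>vector_fields A. \<forall>p.
           nabla (\<lambda>q. X q + Z q) Y p = nabla X Y p + nabla Z Y p \<and>
           nabla X (\<lambda>q. Y q + Z q) p = nabla X Y p + nabla X Z p) \<and>
        (\<forall>f\<in>smooth_funs A. \<forall>p.
           nabla (\<lambda>q. f q *\<^sub>R X q) Y p = f p *\<^sub>R nabla X Y p \<and>
           nabla X (\<lambda>q. f q *\<^sub>R Y q) p = dir_deriv A X f p *\<^sub>R Y p + f p *\<^sub>R nabla X Y p) \<and>
        (\<forall>p. nabla X Y p - nabla Y X p = lie_bracket A X Y p) \<and>
        (\<forall>Z\<in>vector_fields A. \<forall>p.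
           dir_deriv A X (\<lambda>q. g q (Y q) (Z q)) p
             = g p (nabla X Y p) (Z p) + g p (Y p) (nabla X Z p)))"


section \<open>Hermitian and Kaehler structures\<close>

definition almost_hermitian ::
    "('a::topological_space, 'e::euclidean_space) chart set \<Rightarrow> ('a \<Rightarrow> 'e \<Rightarrow> 'e \<Rightarrow> real)
      \<Rightarrow> ('a \<Rightarrow> 'e \<Rightarrow> 'e) \<Rightarrow> bool" where
  "almost_hermitian A g J \<longleftrightarrow>
     riemannian_metric A g \<and> endomorphism_field A J \<and>
     (\<forall>p u. J p (J p u) = - u) \<and> (\<forall>p u v. g p (J p u) (J p v) = g p u v)"

definition nijenhuis ::
    "('a, 'e::euclidean_space) chart set \<Rightarrow> ('a \<Rightarrow> 'e \<Rightarrow> 'e)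
      \<Rightarrow> ('a \<Rightarrow> 'e) \<Rightarrow> ('a \<Rightarrow> 'e) \<Rightarrow> 'a \<Rightarrow> 'e" where
  "nijenhuis A J X Y p =
     lie_bracket A (\<lambda>q. J q (X q)) (\<lambda>q. J q (Y q)) p
     - lie_bracket A X Y p
     - J p (lie_bracket A (\<lambda>q. J q (X q)) Y p)
     - J p (lie_bracket A X (\<lambda>q. J q (Y q)) p)"

text \<open>
  Integrability of an almost complex structure is understood as the vanishing of its Nijenhuis
  tensor.
\<close>

definition integrable_structure ::
    "('a, 'e::euclidean_space) chart set \<Rightarrow> ('a \<Rightarrow> 'e \<Rightarrow> 'e) \<Rightarrow> bool" where
  "integrable_structure A J \<longleftrightarrow>
     (\<forall>X\<in>vector_fields A. \<forall>Y\<in>vector_fields A. \<forall>p. nijenhuis A J X Y p = 0)"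

definition hermitian ::
    "('a::topological_space, 'e::euclidean_space) chart set \<Rightarrow> ('a \<Rightarrow> 'e \<Rightarrow> 'e \<Rightarrow> real)
      \<Rightarrow> ('a \<Rightarrow> 'e \<Rightarrow> 'e) \<Rightarrow> bool" where
  "hermitian A g J \<longleftrightarrow> almost_hermitian A g J \<and> integrable_structure A J"

definition kaehler ::
    "('a::{t2_space, second_countable_topology}, 'e::euclidean_space) chart set
      \<Rightarrow> ('a \<Rightarrow> 'e \<Rightarrow> 'e \<Rightarrow> real) \<Rightarrow> ('a \<Rightarrow> 'e \<Rightarrow> 'e) \<Rightarrow> bool" where
  "kaehler A g J \<longleftrightarrow>
     smooth_atlas A \<and> hermitian A g J \<and>
     (\<forall>X\<in>vector_fields A. \<forall>Y\<in>vector_fields A. \<forall>Z\<in>vector_fields A. \<forall>p.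
        exterior_derivative2 A (\<lambda>q u v. g q (J q u) v) X Y Z p = 0)"

definition kaehler_surface ::
    "('a::{t2_space, second_countable_topology}, real^4) chart set
      \<Rightarrow> ('a \<Rightarrow> real^4 \<Rightarrow> real^4 \<Rightarrow> real) \<Rightarrow> ('a \<Rightarrow> real^4 \<Rightarrow> real^4) \<Rightarrow> bool" where
  "kaehler_surface A g J \<longleftrightarrow> connected (UNIV :: 'a set) \<and> kaehler A g J"


section \<open>Foliations\<close>

definition smooth_distribution ::
    "('a::topological_space, 'e::euclidean_space) chart set \<Rightarrow> nat \<Rightarrow> ('a \<Rightarrow> 'e set) \<Rightarrow> bool" where
  "smooth_distribution A k D \<longleftrightarrow>
     (\<forall>p. subspace (D p) \<and> dim (D p) = k) \<and>
     (\<forall>p. \<exists>U F. open U \<and> p \<in> U \<and> finite F \<and> card F = k \<and>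
        (\<forall>X\<in>F. smooth_field_on A U X) \<and> (\<forall>q\<in>U. D q = span ((\<lambda>X. X q) ` F)))"

text \<open>
  The distribution is tangent to the leaves of a foliation if around every point there is a
  compatible chart \<open>c\<close> in which it becomes a constant subspace \<open>E\<close>: the plaques in the domain of
  \<open>c\<close> are the preimages of the translates of \<open>E\<close>.
\<close>

definition foliation ::
    "('a::{t2_space, second_countable_topology}, 'e::euclidean_space) chart set
      \<Rightarrow> nat \<Rightarrow> ('a \<Rightarrow> 'e set) \<Rightarrow> bool" where
  "foliation A k D \<longleftrightarrow>
     smooth_distribution A k D \<and>
     (\<forall>p. \<exists>c E. smooth_atlas (insert c A) \<and> p \<in> fst c \<and> subspace E \<and> dim E = k \<and>
        (\<forall>q\<in>fst c. D q = {v. in_chart A c q v \<in> E}))"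

definition sections ::
    "('a, 'e::euclidean_space) chart set \<Rightarrow> ('a \<Rightarrow> 'e set) \<Rightarrow> ('a \<Rightarrow> 'e) set" where
  "sections A D = {X \<in> vector_fields A. \<forall>p. X p \<in> D p}"

definition perp :: "('a \<Rightarrow> 'e \<Rightarrow> 'e \<Rightarrow> real) \<Rightarrow> ('a \<Rightarrow> 'e set) \<Rightarrow> 'a \<Rightarrow> 'e set" where
  "perp g D p = {v. \<forall>w\<in>D p. g p v w = 0}"

definition complex_distribution :: "('a \<Rightarrow> 'e \<Rightarrow> 'e) \<Rightarrow> ('a \<Rightarrow> 'e set) \<Rightarrow> bool" where
  "complex_distribution J D \<longleftrightarrow> (\<forall>p. J p ` D p \<subseteq> D p)"

definition conformal_foliation ::
    "('a::topological_space, 'e::euclidean_space) chart set \<Rightarrow> ('a \<Rightarrow> 'e \<Rightarrow> 'e \<Rightarrow> real)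
      \<Rightarrow> ('a \<Rightarrow> 'e set) \<Rightarrow> bool" where
  "conformal_foliation A g D \<longleftrightarrow>
     (\<exists>\<alpha>. one_form A \<alpha> \<and> (\<forall>p. \<forall>v\<in>perp g D p. \<alpha> p v = 0) \<and>
        (\<forall>V\<in>sections A D. \<forall>X\<in>vector_fields A. \<forall>Y\<in>vector_fields A. \<forall>p.
           X p \<in> perp g D p \<and> Y p \<in> perp g D p
             \<longrightarrow> lie_metric A g V X Y p = \<alpha> p (V p) * g p (X p) (Y p)))"

definition totally_geodesic ::
    "('a, 'e::euclidean_space) chart set \<Rightarrow> (('a \<Rightarrow> 'e) \<Rightarrow> ('a \<Rightarrow> 'e) \<Rightarrow> 'a \<Rightarrow> 'e)
      \<Rightarrow> ('a \<Rightarrow> 'e set) \<Rightarrow> bool" where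
  "totally_geodesic A nabla D \<longleftrightarrow>
     (\<forall>X\<in>sections A D. \<forall>Y\<in>sections A D. nabla X Y \<in> sections A D)"

definition holomorphic_foliation ::
    "('a, 'e::euclidean_space) chart set \<Rightarrow> ('a \<Rightarrow> 'e \<Rightarrow> 'e) \<Rightarrow> ('a \<Rightarrow> 'e set) \<Rightarrow> bool" where
  "holomorphic_foliation A J D \<longleftrightarrow>
     (\<forall>V\<in>sections A D. \<forall>X\<in>vector_fields A. \<forall>p. lie_endo A J V X p \<in> D p)"

definition opposite_structure ::
    "('a \<Rightarrow> 'e::real_vector \<Rightarrow> 'e \<Rightarrow> real) \<Rightarrow> ('a \<Rightarrow> 'e \<Rightarrow> 'e) \<Rightarrow> ('a \<Rightarrow> 'e set)
      \<Rightarrow> 'a \<Rightarrow> 'e \<Rightarrow> 'e" where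
  "opposite_structure g J D p =
     (THE L. linear L \<and> (\<forall>v\<in>D p. L v = J p v) \<and> (\<forall>v\<in>perp g D p. L v = - J p v))"

end

theory Submission
  imports Defs
begin

text \<open>
  Let \<open>V\<close> be tangent and \<open>X\<close> orthogonal to \<open>D\<close>. Conformality says that \<open>V\<close> acts conformally on the
  planes \<open>D\<^sup>\<bottom>\<close>, so \<open>L\<^sub>V J\<close> vanishes on \<open>D\<^sup>\<bottom>\<close> modulo \<open>D\<close>: the foliation is holomorphic. Dually,
  \<open>D\<close> is totally geodesic iff \<open>L\<^sub>X g = 0\<close> on \<open>D\<close>, and by the same argument \<open>L\<^sub>X J\<close> vanishes on \<open>D\<close>
  modulo \<open>D\<^sup>\<bottom>\<close>. These two facts express the brackets of \<open>V, JV\<close> with \<open>X, JX\<close> in such a way that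
  \<open>N\<^sub>I(V, X) = 0\<close>. On pairs from \<open>D\<close>, \<open>N\<^sub>I = N\<^sub>J\<close> since \<open>D\<close> is involutive; on pairs from \<open>D\<^sup>\<bottom>\<close> the
  difference is controlled by the \<open>J\<close>-invariance of the skew form \<open>(X, Y) \<mapsto> [X, Y]\<^sup>D\<close>.
\<close>

section \<open>Calculus of C^k and smooth maps\<close>

lemma frechet_derivative_cong_open:
  assumes "open S" "x \<in> S" "\<And>y. y \<in> S \<Longrightarrow> f y = h y"
  shows "frechet_derivative f (at x) = frechet_derivative h (at x)"
proof -
  have "(f has_derivative d) (at x) \<longleftrightarrow> (h has_derivative d) (at x)" for d
    using has_derivative_transform_within_open[OF _ assms(1,2)] assms(3) by metis
  then show ?thesis
    unfolding frechet_derivative_def by simp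
qed

lemma Ck_on_subset: "Ck_on k S f \<Longrightarrow> T \<subseteq> S \<Longrightarrow> Ck_on k T f"
  by (induction k arbitrary: f) (auto intro: continuous_on_subset differentiable_on_subset)

lemma Ck_on_cong:
  assumes "open S" "\<And>x. x \<in> S \<Longrightarrow> f x = h x" "Ck_on k S f"
  shows "Ck_on k S h"
  using assms(2,3)
proof (induction k arbitrary: f h)
  case 0
  then show ?case by (simp cong: continuous_on_cong)
next
  case (Suc k)
  have "h differentiable at x" if "x \<in> S" for x
  proof -
    have "f differentiable at x"
      using Suc.prems(2) assms(1) that by (simp add: differentiable_on_eq_differentiable_at)
    then show ?thesis
      unfolding differentiable_def
      using has_derivative_transform_within_open[of f _ x UNIV S h, OF _ assms(1) that] Suc.prems(1)
      by blast
  qed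
  then have "h differentiable_on S"
    by (rule differentiable_at_imp_differentiable_on)
  moreover have "Ck_on k S (\<lambda>x. frechet_derivative h (at x) v)" for v
    by (rule Suc.IH[of "\<lambda>x. frechet_derivative f (at x) v"])
      (use Suc.prems frechet_derivative_cong_open[OF assms(1), of _ f h] in simp_all)
  ultimately show ?case by simp
qed

text \<open>Continuity and differentiability at a point only see an open neighbourhood. This serves
  the orthogonal projection onto \<open>D\<close>, whose explicit formula changes from one
  neighbourhood to the next.\<close>

lemma Ck_on_local:
  assumes "\<And>x. x \<in> S \<Longrightarrow> \<exists>T. open T \<and> x \<in> T \<and> Ck_on k T f"
  shows "Ck_on k S f"
  using assms
proof (induction k arbitrary: f)
  case 0
  then show ?case
    using continuous_on_eq_continuous_at
    by (metis Ck_on.simps(1) continuous_at_imp_continuous_on)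
next
  case (Suc k)
  have "f differentiable at x" if "x \<in> S" for x
    using Suc.prems[OF that] by (auto simp: differentiable_on_eq_differentiable_at)
  then have "f differentiable_on S"
    by (rule differentiable_at_imp_differentiable_on)
  moreover have "Ck_on k S (\<lambda>x. frechet_derivative f (at x) v)" for v
    using Suc.prems by (intro Suc.IH) (metis Ck_on.simps(2))
  ultimately show ?case by simp
qed

lemma Ck_on_Suc_imp: "Ck_on (Suc k) S f \<Longrightarrow> Ck_on k S f"
  by (induction k arbitrary: f) (auto intro: differentiable_imp_continuous_on)

lemma Ck_on_add:
  assumes "open S" "Ck_on k S f" "Ck_on k S h"
  shows "Ck_on k S (\<lambda>x. f x + h x)"
  using assms(2,3)
proof (induction k arbitrary: f h)
  case 0
  then show ?case by (simp add: continuous_on_add)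
next
  case (Suc k)
  have D: "f differentiable at x" "h differentiable at x" if "x \<in> S" for x
    using Suc.prems that assms(1) by (auto simp: differentiable_on_eq_differentiable_at)
  have "frechet_derivative (\<lambda>x. f x + h x) (at x) v
      = frechet_derivative f (at x) v + frechet_derivative h (at x) v" if "x \<in> S" for x v
    by (rule frechet_derivative_at[OF has_derivative_add, symmetric, THEN fun_cong])
      (use D[OF that] in \<open>simp_all add: frechet_derivative_works[symmetric]\<close>)
  moreover have c: "Ck_on k S (\<lambda>x. frechet_derivative f (at x) v + frechet_derivative h (at x) v)" for v
    using Suc by simp
  ultimately have "Ck_on k S (\<lambda>x. frechet_derivative (\<lambda>x. f x + h x) (at x) v)" for v
    by (intro Ck_on_cong[OF assms(1) _ c[of v]]) simp_all
  then show ?case using Suc.prems by (simp add: differentiable_on_add)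
qed

lemma Ck_on_scaleR:
  fixes f :: "'e::euclidean_space \<Rightarrow> real"
  assumes "open S" "Ck_on k S f" "Ck_on k S h"
  shows "Ck_on k S (\<lambda>x. f x *\<^sub>R h x)"
  using assms(2,3)
proof (induction k arbitrary: f h)
  case 0
  then show ?case by (simp add: continuous_on_scaleR)
next
  case (Suc k)
  have D: "f differentiable at x" "h differentiable at x" if "x \<in> S" for x
    using Suc.prems that assms(1) by (auto simp: differentiable_on_eq_differentiable_at)
  have der: "((\<lambda>x. f x *\<^sub>R h x) has_derivative
      (\<lambda>v. f x *\<^sub>R frechet_derivative h (at x) v + frechet_derivative f (at x) v *\<^sub>R h x)) (at x)"
    if "x \<in> S" for x
    using D[OF that] by (intro has_derivative_scaleR) (auto simp: frechet_derivative_works[symmetric])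
  \<comment> \<open>The Leibniz rule leaves one factor undifferentiated in each term; the induction
    hypothesis wants that factor at order \<open>k\<close>, which is weaker than the given order
    \<open>Suc k\<close>.\<close>
  have c: "Ck_on k S (\<lambda>x. f x *\<^sub>R frechet_derivative h (at x) v + frechet_derivative f (at x) v *\<^sub>R h x)" for v
    using Suc.prems Ck_on_Suc_imp[OF Suc.prems(1)] Ck_on_Suc_imp[OF Suc.prems(2)]
    by (intro Ck_on_add[OF assms(1)] Suc.IH) simp_all
  have "Ck_on k S (\<lambda>x. frechet_derivative (\<lambda>x. f x *\<^sub>R h x) (at x) v)" for v
    by (rule Ck_on_cong[OF assms(1) _ c[of v]]) (simp add: frechet_derivative_at[OF der, symmetric])
  moreover have "(\<lambda>x. f x *\<^sub>R h x) differentiable_on S"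
    using der by (blast intro: differentiable_at_imp_differentiable_on differentiableI)
  ultimately show ?case by simp
qed

lemma Ck_on_inverse:
  fixes f :: "'e::euclidean_space \<Rightarrow> real"
  assumes "open S" "Ck_on k S f" "\<And>x. x \<in> S \<Longrightarrow> f x \<noteq> 0"
  shows "Ck_on k S (\<lambda>x. inverse (f x))"
  using assms(2,3)
proof (induction k arbitrary: f)
  case 0
  then show ?case by (simp add: continuous_on_inverse)
next
  case (Suc k)
  have D: "f differentiable at x" if "x \<in> S" for x
    using Suc.prems that assms(1) by (auto simp: differentiable_on_eq_differentiable_at)
  \<comment> \<open>The derivative is arranged as nested products of \<open>f'\<close> and
    \<open>1/f\<close>: the induction hypothesis makes \<open>1/f\<close> of class C^k, and the
    product rule already proved does the rest.\<close>
  have der: "((\<lambda>x. inverse (f x)) has_derivative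
      (\<lambda>v. (- 1 *\<^sub>R inverse (f x)) *\<^sub>R (frechet_derivative f (at x) v *\<^sub>R inverse (f x)))) (at x)"
    if "x \<in> S" for x
    using Deriv.has_derivative_inverse[of f x "frechet_derivative f (at x)" UNIV,
        OF Suc.prems(2)[OF that]] D[OF that]
    by (simp add: frechet_derivative_works mult_ac)
  have const: "Ck_on j S (\<lambda>x. c)" for j and c :: real
    by (induction j arbitrary: c) auto
  have c: "Ck_on k S (\<lambda>x. (- 1 *\<^sub>R inverse (f x)) *\<^sub>R (frechet_derivative f (at x) v *\<^sub>R inverse (f x)))" for v
    using Suc.prems Ck_on_Suc_imp[OF Suc.prems(1)]
    by (intro Ck_on_scaleR[OF assms(1)] Suc.IH const) simp_all
  have "Ck_on k S (\<lambda>x. frechet_derivative (\<lambda>x. inverse (f x)) (at x) v)" for v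
    by (rule Ck_on_cong[OF assms(1) _ c[of v]]) (simp add: frechet_derivative_at[OF der, symmetric])
  moreover have "(\<lambda>x. inverse (f x)) differentiable_on S"
    using der by (blast intro: differentiable_at_imp_differentiable_on differentiableI)
  ultimately show ?case by simp
qed


lemma smooth_on_subset: "smooth_on S f \<Longrightarrow> T \<subseteq> S \<Longrightarrow> smooth_on T f"
  unfolding smooth_on_def using Ck_on_subset by blast

lemma smooth_on_cong:
  "open S \<Longrightarrow> (\<And>x. x \<in> S \<Longrightarrow> f x = h x) \<Longrightarrow> smooth_on S f \<Longrightarrow> smooth_on S h"
  unfolding smooth_on_def using Ck_on_cong by blast

lemma smooth_on_local:
  "(\<And>x. x \<in> S \<Longrightarrow> \<exists>T. open T \<and> x \<in> T \<and> smooth_on T f) \<Longrightarrow> smooth_on S f"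
  unfolding smooth_on_def by (intro allI Ck_on_local) blast

lemma smooth_on_add:
  "open S \<Longrightarrow> smooth_on S f \<Longrightarrow> smooth_on S h \<Longrightarrow> smooth_on S (\<lambda>x. f x + h x)"
  unfolding smooth_on_def by (simp add: Ck_on_add)

lemma smooth_on_scaleR:
  fixes f :: "'e::euclidean_space \<Rightarrow> real"
  shows "open S \<Longrightarrow> smooth_on S f \<Longrightarrow> smooth_on S h \<Longrightarrow> smooth_on S (\<lambda>x. f x *\<^sub>R h x)"
  unfolding smooth_on_def by (simp add: Ck_on_scaleR)

lemma smooth_on_inverse:
  fixes f :: "'e::euclidean_space \<Rightarrow> real"
  shows "open S \<Longrightarrow> smooth_on S f \<Longrightarrow> (\<And>x. x \<in> S \<Longrightarrow> f x \<noteq> 0) \<Longrightarrow> smooth_on S (\<lambda>x. inverse (f x))"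
  unfolding smooth_on_def by (simp add: Ck_on_inverse)

lemma smooth_on_const: "smooth_on S (\<lambda>x. c)"
proof -
  have "Ck_on k S (\<lambda>x. c)" for k
    by (induction k arbitrary: c) auto
  then show ?thesis by (simp add: smooth_on_def)
qed

lemma smooth_on_imp_continuous_on: "smooth_on S f \<Longrightarrow> continuous_on S f"
  unfolding smooth_on_def by (drule spec[of _ 0]) simp

lemma smooth_on_imp_differentiable_at:
  "smooth_on S f \<Longrightarrow> open S \<Longrightarrow> x \<in> S \<Longrightarrow> f differentiable at x"
  unfolding smooth_on_def
  by (drule spec[of _ "Suc 0"]) (simp add: differentiable_on_eq_differentiable_at)

section \<open>Vector fields on a manifold\<close>

locale smooth_manifold =
  fixes A :: "('a::{t2_space, second_countable_topology}, 'e::euclidean_space) chart set"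
  assumes atlas: "smooth_atlas A"
begin

lemma open_chart_image:
  assumes "c \<in> A" "open U"
  shows "open (snd c ` (fst c \<inter> U))"
proof -
  have c: "open (fst c)" "open (snd c ` fst c)"
      "homeomorphism (fst c) (snd c ` fst c) (snd c) (chart_inv c)"
    using atlas assms(1) unfolding smooth_atlas_def by blast+
  have "openin (top_of_set (fst c)) (fst c \<inter> U)"
    using assms(2) by blast
  from homeomorphism_imp_open_map[OF c(3) this] show ?thesis
    using c(2) openin_open_trans by blast
qed

lemma chart_at_mem: "chart_at A p \<in> A" "p \<in> fst (chart_at A p)"
proof -
  have "\<exists>c. c \<in> A \<and> p \<in> fst c"
    using atlas unfolding smooth_atlas_def by blast
  from someI_ex[OF this] show "chart_at A p \<in> A" "p \<in> fst (chart_at A p)"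
    unfolding chart_at_def by auto
qed

lemma chart_inv_chart: "c \<in> A \<Longrightarrow> p \<in> fst c \<Longrightarrow> chart_inv c (snd c p) = p"
  using atlas unfolding smooth_atlas_def homeomorphism_def by blast

lemma linear_in_chart:
  assumes "c \<in> A" "p \<in> fst c"
  shows "linear (in_chart A c p)"
proof -
  let ?d = "chart_at A p"
  have "smooth_on (snd ?d ` (fst ?d \<inter> fst c)) (snd c \<circ> chart_inv ?d)"
    using atlas assms(1) chart_at_mem unfolding smooth_atlas_def by blast
  moreover have "open (snd ?d ` (fst ?d \<inter> fst c))"
    using open_chart_image chart_at_mem atlas assms(1) unfolding smooth_atlas_def by blast
  ultimately have "(snd c \<circ> chart_inv ?d) differentiable at (snd ?d p)"
    using assms chart_at_mem by (intro smooth_on_imp_differentiable_at) auto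
  then show ?thesis
    unfolding in_chart_def by (rule linear_frechet_derivative)
qed

lemma linear_in_chart_inv:
  assumes "c \<in> A" "x \<in> snd c ` fst c"
  shows "linear (in_chart A c (chart_inv c x))"
proof -
  obtain p where "p \<in> fst c" "x = snd c p"
    using assms(2) by blast
  then show ?thesis
    using linear_in_chart chart_inv_chart assms(1) by simp
qed

lemma local_rep_add:
  assumes "c \<in> A" "x \<in> snd c ` fst c"
  shows "local_rep A c (\<lambda>q. X q + Y q) x = local_rep A c X x + local_rep A c Y x"
  unfolding local_rep_def by (rule linear_add[OF linear_in_chart_inv[OF assms]])

lemma local_rep_scaleR:
  assumes "c \<in> A" "x \<in> snd c ` fst c"
  shows "local_rep A c (\<lambda>q. f q *\<^sub>R X q) x = (f \<circ> chart_inv c) x *\<^sub>R local_rep A c X x"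
  unfolding local_rep_def o_def by (rule linear_scale[OF linear_in_chart_inv[OF assms]])

lemma smooth_field_on_subset: "smooth_field_on A U X \<Longrightarrow> V \<subseteq> U \<Longrightarrow> smooth_field_on A V X"
  unfolding smooth_field_on_def by (blast intro: smooth_on_subset)

lemma smooth_field_on_add:
  assumes "open U" "smooth_field_on A U X" "smooth_field_on A U Y"
  shows "smooth_field_on A U (\<lambda>q. X q + Y q)"
  unfolding smooth_field_on_def
proof
  fix c assume c: "c \<in> A"
  have o: "open (snd c ` (fst c \<inter> U))"
    using c assms(1) by (rule open_chart_image)
  show "smooth_on (snd c ` (fst c \<inter> U)) (local_rep A c (\<lambda>q. X q + Y q))"
    by (rule smooth_on_cong[OF o _ smooth_on_add[OF o]])
      (use assms c in \<open>auto simp: smooth_field_on_def local_rep_add\<close>)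
qed

lemma smooth_field_on_scaleR:
  assumes "open U" "smooth_fun_on A U f" "smooth_field_on A U X"
  shows "smooth_field_on A U (\<lambda>q. f q *\<^sub>R X q)"
  unfolding smooth_field_on_def
proof
  fix c assume c: "c \<in> A"
  have o: "open (snd c ` (fst c \<inter> U))"
    using c assms(1) by (rule open_chart_image)
  show "smooth_on (snd c ` (fst c \<inter> U)) (local_rep A c (\<lambda>q. f q *\<^sub>R X q))"
    by (rule smooth_on_cong[OF o _ smooth_on_scaleR[OF o]])
      (use assms c in \<open>auto simp: smooth_field_on_def smooth_fun_on_def local_rep_scaleR o_def\<close>)
qed

lemma smooth_fun_on_const: "smooth_fun_on A U (\<lambda>q. k)"
  by (simp add: smooth_fun_on_def o_def smooth_on_const)

lemma vector_fields_add:
  "X \<in> vector_fields A \<Longrightarrow> Y \<in> vector_fields A \<Longrightarrow> (\<lambda>q. X q + Y q) \<in> vector_fields A"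
  unfolding vector_fields_def by (simp add: smooth_field_on_add)

lemma vector_fields_scaleR:
  "f \<in> smooth_funs A \<Longrightarrow> X \<in> vector_fields A \<Longrightarrow> (\<lambda>q. f q *\<^sub>R X q) \<in> vector_fields A"
  unfolding vector_fields_def smooth_funs_def by (simp add: smooth_field_on_scaleR)

lemma vector_fields_uminus: "X \<in> vector_fields A \<Longrightarrow> (\<lambda>q. - X q) \<in> vector_fields A"
  using vector_fields_scaleR[of "\<lambda>q. -1" X] by (simp add: smooth_funs_def smooth_fun_on_const)

lemma vector_fields_diff:
  "X \<in> vector_fields A \<Longrightarrow> Y \<in> vector_fields A \<Longrightarrow> (\<lambda>q. X q - Y q) \<in> vector_fields A"
  using vector_fields_add[OF _ vector_fields_uminus] by fastforce

lemma dir_deriv_const: "dir_deriv A X (\<lambda>q. k) p = 0"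
  by (simp add: dir_deriv_def o_def)

lemma lie_bracket_skew: "lie_bracket A Y X p = - lie_bracket A X Y p"
  by (simp add: lie_bracket_def Let_def)

lemma lie_bracket_self: "lie_bracket A X X p = 0"
  by (simp add: lie_bracket_def Let_def)

text \<open>In coordinates the bracket is \<open>DY(X) - DX(Y)\<close>, and both differentials are
  linear maps applied to zero vectors. It settles points where neither field can serve as half of a
  frame.\<close>

lemma lie_bracket_eq_0_at_common_zero:
  assumes "X \<in> vector_fields A" "Y \<in> vector_fields A" "X p = 0" "Y p = 0"
  shows "lie_bracket A X Y p = 0"
proof -
  let ?c = "chart_at A p"
  have "linear (frechet_derivative (local_rep A ?c Z) (at (snd ?c p)))" if "Z \<in> vector_fields A" for Z
  proof (rule linear_frechet_derivative, rule smooth_on_imp_differentiable_at)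
    show "smooth_on (snd ?c ` (fst ?c \<inter> UNIV)) (local_rep A ?c Z)"
      using that chart_at_mem(1)[of p] unfolding vector_fields_def smooth_field_on_def by blast
    show "open (snd ?c ` (fst ?c \<inter> UNIV))"
      by (rule open_chart_image[OF chart_at_mem(1) open_UNIV])
    show "snd ?c p \<in> snd ?c ` (fst ?c \<inter> UNIV)"
      using chart_at_mem(2)[of p] by blast
  qed
  from this[OF assms(1)] this[OF assms(2)] show ?thesis
    by (simp add: lie_bracket_def Let_def assms linear_0)
qed

end

section \<open>Metric, Levi-Civita connection and the bracket rules derived from them\<close>

locale riemannian_manifold = smooth_manifold A
  for A :: "('a::{t2_space, second_countable_topology}, 'e::euclidean_space) chart set" +
  fixes g :: "'a \<Rightarrow> 'e \<Rightarrow> 'e \<Rightarrow> real"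
    and nabla :: "('a \<Rightarrow> 'e) \<Rightarrow> ('a \<Rightarrow> 'e) \<Rightarrow> 'a \<Rightarrow> 'e"
  assumes metric: "riemannian_metric A g"
    and connection: "levi_civita A g nabla"
begin

lemma g_bilinear: "bilinear (g p)"
  and g_sym: "g p u v = g p v u"
  and g_pos: "u \<noteq> 0 \<Longrightarrow> 0 < g p u u"
  using metric unfolding riemannian_metric_def by blast+

lemmas g_simps = bilinear_ladd[OF g_bilinear] bilinear_radd[OF g_bilinear]
  bilinear_lsub[OF g_bilinear] bilinear_rsub[OF g_bilinear]
  bilinear_lneg[OF g_bilinear] bilinear_rneg[OF g_bilinear]
  bilinear_lzero[OF g_bilinear] bilinear_rzero[OF g_bilinear]
  bilinear_lmul[OF g_bilinear] bilinear_rmul[OF g_bilinear]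

lemma g_eq_0_iff: "g p u u = 0 \<longleftrightarrow> u = 0"
  using g_pos[of u p] by (cases "u = 0") (auto simp: g_simps)

lemma smooth_funs_g:
  "X \<in> vector_fields A \<Longrightarrow> Y \<in> vector_fields A \<Longrightarrow> (\<lambda>q. g q (X q) (Y q)) \<in> smooth_funs A"
  using metric unfolding riemannian_metric_def vector_fields_def smooth_funs_def by blast

lemma subspace_perp: "subspace (perp g D p)"
  by (auto simp: subspace_def perp_def g_simps)

lemma nabla_vector_fields:
  "X \<in> vector_fields A \<Longrightarrow> Y \<in> vector_fields A \<Longrightarrow> nabla X Y \<in> vector_fields A"
  using connection unfolding levi_civita_def by blast

lemma nabla_add:
  assumes "X \<in> vector_fields A" "Y \<in> vector_fields A" "Z \<in> vector_fields A"
  shows "nabla (\<lambda>q. X q + Z q) Y p = nabla X Y p + nabla Z Y p"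
    "nabla X (\<lambda>q. Y q + Z q) p = nabla X Y p + nabla X Z p"
  using connection assms unfolding levi_civita_def by blast+

lemma nabla_scaleR:
  assumes "X \<in> vector_fields A" "Y \<in> vector_fields A" "f \<in> smooth_funs A"
  shows "nabla (\<lambda>q. f q *\<^sub>R X q) Y p = f p *\<^sub>R nabla X Y p"
    "nabla X (\<lambda>q. f q *\<^sub>R Y q) p = dir_deriv A X f p *\<^sub>R Y p + f p *\<^sub>R nabla X Y p"
  using connection assms unfolding levi_civita_def by blast+

lemma lie_bracket_nabla:
  "X \<in> vector_fields A \<Longrightarrow> Y \<in> vector_fields A \<Longrightarrow>
    lie_bracket A X Y p = nabla X Y p - nabla Y X p"
  using connection unfolding levi_civita_def by simp

lemma dir_deriv_metric:
  assumes "X \<in> vector_fields A" "Y \<in> vector_fields A" "Z \<in> vector_fields A"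
  shows "dir_deriv A X (\<lambda>q. g q (Y q) (Z q)) p
    = g p (nabla X Y p) (Z p) + g p (Y p) (nabla X Z p)"
  using connection assms unfolding levi_civita_def by blast

text \<open>Torsion-freeness writes the bracket through \<open>nabla\<close>, so its smoothness, and
  below its additivity and Leibniz rule, come from the connection axioms instead of coordinate
  computations.\<close>

lemma lie_bracket_vector_fields:
  assumes "X \<in> vector_fields A" "Y \<in> vector_fields A"
  shows "lie_bracket A X Y \<in> vector_fields A"
proof -
  have "lie_bracket A X Y = (\<lambda>q. nabla X Y q - nabla Y X q)"
    using lie_bracket_nabla assms by blast
  then show ?thesis
    using assms by (simp add: vector_fields_diff nabla_vector_fields)
qed

lemma lie_bracket_add_right:
  assumes "X \<in> vector_fields A" "Y \<in> vector_fields A" "Z \<in> vector_fields A"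
  shows "lie_bracket A X (\<lambda>q. Y q + Z q) p = lie_bracket A X Y p + lie_bracket A X Z p"
  using assms by (simp add: lie_bracket_nabla vector_fields_add nabla_add)

lemma lie_bracket_scaleR_right:
  assumes "X \<in> vector_fields A" "Y \<in> vector_fields A" "f \<in> smooth_funs A"
  shows "lie_bracket A X (\<lambda>q. f q *\<^sub>R Y q) p = f p *\<^sub>R lie_bracket A X Y p + dir_deriv A X f p *\<^sub>R Y p"
  using assms by (simp add: lie_bracket_nabla vector_fields_scaleR nabla_scaleR algebra_simps)

lemma lie_bracket_uminus_right:
  assumes "X \<in> vector_fields A" "Y \<in> vector_fields A"
  shows "lie_bracket A X (\<lambda>q. - Y q) p = - lie_bracket A X Y p"
  using lie_bracket_scaleR_right[OF assms, of "\<lambda>q. -1" p]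
  by (simp add: smooth_funs_def smooth_fun_on_const dir_deriv_const)

lemma lie_bracket_uminus_left:
  assumes "X \<in> vector_fields A" "Y \<in> vector_fields A"
  shows "lie_bracket A (\<lambda>q. - X q) Y p = - lie_bracket A X Y p"
  using lie_bracket_uminus_right[OF assms(2,1), of p]
    lie_bracket_skew[of "\<lambda>q. - X q" Y p] lie_bracket_skew[of Y X p] by simp

end

section \<open>Complex plane fields\<close>

text \<open>For \<open>x \<noteq> 0\<close> the vectors \<open>x\<close> and \<open>L x\<close> are
  orthogonal of equal length, hence a basis of the plane, and the coefficients are read off by
  pairing. Multiplying through by \<open>h x x\<close> avoids division, so that the identity
  persists at zeros of a vector field and its coefficients are smooth everywhere.\<close>

lemma complex_plane_expansion:
  fixes h :: "'e::euclidean_space \<Rightarrow> 'e \<Rightarrow> real"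
  assumes h: "bilinear h" "\<And>u v. h u v = h v u" "\<And>u. u \<noteq> 0 \<Longrightarrow> 0 < h u u"
    and L: "\<And>u. L (L u) = - u" "\<And>u v. h (L u) (L v) = h u v"
    and E: "subspace E" "dim E = 2" "\<And>u. u \<in> E \<Longrightarrow> L u \<in> E"
    and x: "x \<in> E" and y: "y \<in> E"
  shows "h x x *\<^sub>R y = h y x *\<^sub>R x + h y (L x) *\<^sub>R L x"
proof (cases "x = 0")
  case True
  \<comment> \<open>\<open>L 0 = 0\<close> is obtained from the isometry condition and definiteness,
    as \<open>L\<close> is not assumed linear.\<close>
  then show ?thesis
    using E(1) y L(2)[of x x] h(1) h(3)[of "L x"] by (cases "L x = 0") (auto simp: bilinear_lzero bilinear_rzero)
next
  case False
  have orth: "h x (L x) = 0"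
    using L(2)[of x "L x"] L(1)[of x] h(2)[of x "L x"] bilinear_rneg[OF h(1), of "L x" x] by simp
  have pos: "h x x > 0" "h (L x) (L x) = h x x"
    using False h(3) L(2) by auto
  have Lx: "L x \<notin> span {x}"
  proof
    assume "L x \<in> span {x}"
    then obtain k where k: "L x = k *\<^sub>R x"
      by (auto simp: span_singleton)
    then have "h x (L x) = k * h x x"
      using bilinear_rmul[OF h(1)] by simp
    then have "k = 0" using orth pos by simp
    then have "h (L x) (L x) = 0"
      using k bilinear_lzero[OF h(1)] by simp
    then show False using pos by simp
  qed
  have "independent {L x, x}"
    using Lx False by (auto simp: independent_insert span_base)
  moreover have "card {L x, x} = 2"
    using Lx span_base[of x "{x}"] by (auto simp: card_insert_if)
  ultimately have "dim (span {L x, x}) = 2"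
    using dim_eq_card_independent[of "{L x, x}"] by simp
  moreover have "span {L x, x} \<subseteq> E"
    using E x by (intro span_minimal) auto
  ultimately have "span {L x, x} = E"
    using E by (intro subspace_dim_equal) auto
  then obtain a b where y: "y = a *\<^sub>R x + b *\<^sub>R L x"
    using y by (auto simp: span_insert span_singleton algebra_simps)
  then have "h y x = a * h x x" "h y (L x) = b * h x x"
    using orth pos h(2)[of "L x" x]
    by (simp_all add: bilinear_ladd[OF h(1)] bilinear_lmul[OF h(1)])
  then show ?thesis
    by (simp add: y algebra_simps)
qed

locale complex_plane_field = riemannian_manifold A g nabla
  for A :: "('a::{t2_space, second_countable_topology}, real^4) chart set"
    and g nabla +
  fixes J :: "'a \<Rightarrow> real^4 \<Rightarrow> real^4" and D :: "'a \<Rightarrow> (real^4) set"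
  assumes hermitian_J: "almost_hermitian A g J"
    and distribution: "smooth_distribution A 2 D"
    and complex: "complex_distribution J D"
begin

lemma J_linear: "linear (J p)"
  and J_J: "J p (J p u) = - u"
  and g_J_J: "g p (J p u) (J p v) = g p u v"
  using hermitian_J unfolding almost_hermitian_def endomorphism_field_def by blast+

lemmas J_simps = linear_add[OF J_linear] linear_diff[OF J_linear] linear_neg[OF J_linear]
  linear_0[OF J_linear] linear_scale[OF J_linear] J_J

lemma g_J_left: "g p (J p u) v = - g p u (J p v)"
  using g_J_J[of p u "J p v"] by (simp add: J_J g_simps)

lemma g_J_self: "g p u (J p u) = 0"
  using g_J_left[of p u u] g_sym[of p u "J p u"] by simp

lemma smooth_field_on_J: "open U \<Longrightarrow> smooth_field_on A U X \<Longrightarrow> smooth_field_on A U (\<lambda>q. J q (X q))"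
  using hermitian_J unfolding almost_hermitian_def endomorphism_field_def by blast

lemma vector_fields_J: "X \<in> vector_fields A \<Longrightarrow> (\<lambda>q. J q (X q)) \<in> vector_fields A"
  unfolding vector_fields_def using smooth_field_on_J by simp

lemma subspace_D: "subspace (D p)" and dim_D: "dim (D p) = 2"
  using distribution unfolding smooth_distribution_def by blast+

lemma J_in_D: "u \<in> D p \<Longrightarrow> J p u \<in> D p"
  using complex unfolding complex_distribution_def by blast

lemma J_in_perp: "u \<in> perp g D p \<Longrightarrow> J p u \<in> perp g D p"
  using J_in_D unfolding perp_def by (simp add: g_J_left)

section \<open>The orthogonal projection onto the plane field\<close>

lemma D_perp_0:
  assumes "u \<in> D p" "u \<in> perp g D p"
  shows "u = 0"
proof -
  have "g p u u = 0"
    using assms unfolding perp_def by blast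
  then show ?thesis by (simp add: g_eq_0_iff)
qed

definition P :: "'a \<Rightarrow> real^4 \<Rightarrow> real^4" where
  "P p u = (SOME w. w \<in> D p \<and> u - w \<in> perp g D p)"

text \<open>The usual projection formula in the orthogonal frame \<open>v\<close>,
  \<open>J v\<close>, whose members have equal length. Besides existence of the projection it
  supplies the local expression from which smoothness is deduced.\<close>

lemma P_candidate:
  fixes u v :: "real^4"
  assumes v: "v \<in> D p" "v \<noteq> 0"
  defines "w \<equiv> inverse (g p v v) *\<^sub>R (g p u v *\<^sub>R v + g p u (J p v) *\<^sub>R J p v)"
  shows "w \<in> D p \<and> u - w \<in> perp g D p"
proof
  show "w \<in> D p"
    unfolding w_def using v J_in_D subspace_D by (intro subspace_scale subspace_add) auto
  have pos: "g p v v > 0"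
    using v g_pos by blast
  have "g p (u - w) z = 0" if z: "z \<in> D p" for z
  proof -
    \<comment> \<open>Expanding the test vector \<open>z\<close> in the same frame and pairing with
      \<open>u\<close> shows that \<open>u\<close> and \<open>w\<close> have the same inner product
      with \<open>z\<close>.\<close>
    have "g p v v *\<^sub>R z = g p z v *\<^sub>R v + g p z (J p v) *\<^sub>R J p v"
      using z v by (intro complex_plane_expansion[of _ _ "D p"])
        (auto simp: g_bilinear g_pos g_J_J J_J subspace_D dim_D J_in_D intro: g_sym)
    then have "g p u (g p v v *\<^sub>R z) = g p u (g p z v *\<^sub>R v + g p z (J p v) *\<^sub>R J p v)"
      by simp
    then have "g p v v * g p u z = g p z v * g p u v + g p z (J p v) * g p u (J p v)"
      by (simp add: g_simps)
    then show ?thesis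
      using pos by (simp add: w_def g_simps g_sym[of p z] field_simps)
  qed
  then show "u - w \<in> perp g D p"
    unfolding perp_def by blast
qed

lemma D_nonzero: obtains v where "v \<in> D p" "v \<noteq> 0"
proof -
  have "\<not> D p \<subseteq> {0}"
    using dim_D[of p] dim_eq_0[of "D p"] by simp
  then show ?thesis using that by blast
qed

lemma P_in_D: "P p u \<in> D p" and P_perp: "u - P p u \<in> perp g D p"
proof -
  obtain v where "v \<in> D p" "v \<noteq> 0"
    by (rule D_nonzero)
  then have "\<exists>w. w \<in> D p \<and> u - w \<in> perp g D p"
    using P_candidate by blast
  from someI_ex[OF this] show "P p u \<in> D p" "u - P p u \<in> perp g D p"
    unfolding P_def by auto
qed

lemma P_unique:
  assumes "w \<in> D p" "u - w \<in> perp g D p"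
  shows "P p u = w"
proof -
  have "(u - w) - (u - P p u) \<in> perp g D p"
    by (rule subspace_diff[OF subspace_perp assms(2) P_perp])
  moreover have "(u - w) - (u - P p u) = P p u - w"
    by simp
  moreover have "P p u - w \<in> D p"
    by (rule subspace_diff[OF subspace_D P_in_D assms(1)])
  ultimately show ?thesis using D_perp_0[of "P p u - w" p] by simp
qed

lemma P_linear: "linear (P p)"
proof (rule linearI)
  show "P p (u + v) = P p u + P p v" for u v
  proof (rule P_unique)
    show "P p u + P p v \<in> D p"
      by (intro subspace_add subspace_D P_in_D)
    have "(u - P p u) + (v - P p v) \<in> perp g D p"
      by (intro subspace_add subspace_perp P_perp)
    then show "u + v - (P p u + P p v) \<in> perp g D p"
      by (simp add: algebra_simps)
  qed
  show "P p (k *\<^sub>R u) = k *\<^sub>R P p u" for k u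
  proof (rule P_unique)
    show "k *\<^sub>R P p u \<in> D p"
      by (intro subspace_scale subspace_D P_in_D)
    have "k *\<^sub>R (u - P p u) \<in> perp g D p"
      by (intro subspace_scale subspace_perp P_perp)
    then show "k *\<^sub>R u - k *\<^sub>R P p u \<in> perp g D p"
      by (simp add: scaleR_diff_right)
  qed
qed

lemmas P_simps = linear_add[OF P_linear] linear_diff[OF P_linear] linear_neg[OF P_linear]
  linear_0[OF P_linear] linear_scale[OF P_linear]

lemma P_D: "u \<in> D p \<Longrightarrow> P p u = u"
  by (rule P_unique) (auto simp: subspace_0 subspace_perp)

lemma P_perp_eq_0: "u \<in> perp g D p \<Longrightarrow> P p u = 0"
  by (rule P_unique) (auto simp: subspace_0 subspace_D)

lemma P_J: "P p (J p u) = J p (P p u)"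
  using J_in_D[OF P_in_D] J_in_perp[OF P_perp, of p u] by (intro P_unique) (auto simp: J_simps)

lemma P_P: "P p (P p u) = P p u"
  by (simp add: P_D P_in_D)

text \<open>\<open>D p\<close> and its complement span the tangent space and meet only in zero;
  since the ambient dimension is 4, the complement is a plane too. Everything said about complex
  planes thus applies to both distributions.\<close>

lemma dim_perp: "dim (perp g D p) = 2"
proof -
  have "u \<in> {x + y |x y. x \<in> D p \<and> y \<in> perp g D p}" for u
  proof -
    have "u = P p u + (u - P p u)"
      by simp
    then show ?thesis
      using P_in_D[of p u] P_perp[of u p] by blast
  qed
  then have "{x + y |x y. x \<in> D p \<and> y \<in> perp g D p} = UNIV"
    by blast
  moreover have "dim (D p \<inter> perp g D p) = 0"
    using D_perp_0 by (subst dim_eq_0) blast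
  ultimately show ?thesis
    using dim_sums_Int[OF subspace_D[of p] subspace_perp[of D p]] dim_D[of p]
    by (simp del: dim_eq_0)
qed

text \<open>Near each point a single nonvanishing local section \<open>Y\<close> of \<open>D\<close>
  suffices: \<open>Y\<close> and \<open>J Y\<close> form a frame, and \<open>P_candidate\<close>
  with \<open>v = Y\<close> is a smooth expression wherever \<open>Y\<close> has no zero.\<close>

lemma smooth_field_on_P:
  assumes U: "open U" and X: "smooth_field_on A U X"
  shows "smooth_field_on A U (\<lambda>q. P q (X q))"
  unfolding smooth_field_on_def
proof
  fix c assume c: "c \<in> A"
  show "smooth_on (snd c ` (fst c \<inter> U)) (local_rep A c (\<lambda>q. P q (X q)))"
  proof (rule smooth_on_local)
    fix x assume "x \<in> snd c ` (fst c \<inter> U)"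
    then obtain q0 where q0: "q0 \<in> fst c" "q0 \<in> U" "x = snd c q0"
      by blast
    obtain V F where V: "open V" "q0 \<in> V" "\<forall>Y\<in>F. smooth_field_on A V Y"
        "\<forall>q\<in>V. D q = span ((\<lambda>Y. Y q) ` F)"
      using distribution unfolding smooth_distribution_def by meson
    \<comment> \<open>If every field of the local frame vanished at \<open>q0\<close>, their span
      would have dimension 0 instead of 2.\<close>
    have "\<not> (\<lambda>Y. Y q0) ` F \<subseteq> {0}"
      using dim_D[of q0] V dim_span[of "(\<lambda>Y. Y q0) ` F"] dim_eq_0 by (metis zero_neq_numeral)
    then obtain Y where Y: "Y \<in> F" "Y q0 \<noteq> 0"
      by blast
    define W where "W = U \<inter> V"
    have W: "open W" "q0 \<in> W"
      using U V q0 by (auto simp: W_def)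
    have sm: "smooth_field_on A W X" "smooth_field_on A W Y"
      using X V(3) Y(1) unfolding W_def by (auto elim: smooth_field_on_subset)
    define n where "n = (\<lambda>q. g q (Y q) (Y q))"
    define R where "R = (\<lambda>q. g q (X q) (Y q) *\<^sub>R Y q + g q (X q) (J q (Y q)) *\<^sub>R J q (Y q))"
    have sg: "smooth_fun_on A W (\<lambda>q. g q (X1 q) (X2 q))"
      if "smooth_field_on A W X1" "smooth_field_on A W X2" for X1 X2
      using metric that W(1) unfolding riemannian_metric_def by blast
    have R: "smooth_field_on A W R"
      unfolding R_def by (intro smooth_field_on_add smooth_field_on_scaleR sg smooth_field_on_J W sm)
    let ?S = "snd c ` (fst c \<inter> W)"
    have S: "open ?S"
      using c W(1) by (rule open_chart_image)
    have n: "smooth_on ?S (n \<circ> chart_inv c)"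
      using sg[OF sm(2,2)] c unfolding smooth_fun_on_def n_def by blast
    \<comment> \<open>\<open>T\<close> is the coordinate image of the points of \<open>W\<close>
      where the squared length \<open>n\<close> of \<open>Y\<close> is nonzero; continuity of
      \<open>n\<close> makes it open.\<close>
    define T where "T = ?S \<inter> (n \<circ> chart_inv c) -` (- {0})"
    have T: "open T"
      unfolding T_def using smooth_on_imp_continuous_on[OF n] S
      by (rule continuous_open_preimage) auto
    have "x \<in> T"
      using q0 W Y c by (auto simp: T_def n_def chart_inv_chart g_eq_0_iff)
    have eq: "inverse ((n \<circ> chart_inv c) y) *\<^sub>R local_rep A c R y
        = local_rep A c (\<lambda>q. P q (X q)) y" if y: "y \<in> T" for y
    proof -
      obtain q where q: "q \<in> fst c" "q \<in> W" "y = snd c q"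
        using y by (auto simp: T_def)
      then have "Y q \<noteq> 0"
        using y c by (auto simp: T_def n_def chart_inv_chart g_simps)
      moreover have "Y q \<in> D q"
        using V(4) Y(1) q(2) by (auto simp: W_def intro: span_base)
      ultimately have "P q (X q) = inverse (n q) *\<^sub>R R q"
        using P_candidate[of "Y q" q "X q"] P_unique unfolding n_def R_def by blast
      then show ?thesis
        using q c linear_scale[OF linear_in_chart[OF c q(1)]]
        by (simp add: local_rep_def chart_inv_chart)
    qed
    have "smooth_on T (\<lambda>y. inverse ((n \<circ> chart_inv c) y) *\<^sub>R local_rep A c R y)"
    proof (intro smooth_on_scaleR smooth_on_inverse T)
      show "smooth_on T (n \<circ> chart_inv c)"
        using n by (rule smooth_on_subset) (auto simp: T_def)
      have "smooth_on ?S (local_rep A c R)"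
        using R c unfolding smooth_field_on_def by blast
      then show "smooth_on T (local_rep A c R)"
        by (rule smooth_on_subset) (auto simp: T_def)
    qed (auto simp: T_def)
    then have "smooth_on T (local_rep A c (\<lambda>q. P q (X q)))"
      by (rule smooth_on_cong[OF T, rotated]) (rule eq)
    then show "\<exists>T. open T \<and> x \<in> T \<and> smooth_on T (local_rep A c (\<lambda>q. P q (X q)))"
      using T \<open>x \<in> T\<close> by blast
  qed
qed

lemma vector_fields_P: "X \<in> vector_fields A \<Longrightarrow> (\<lambda>q. P q (X q)) \<in> vector_fields A"
  unfolding vector_fields_def using smooth_field_on_P by simp

section \<open>The Lie derivative of \<open>J\<close> along a field acting conformally on
  planes\<close>

lemma lie_endo_vector_fields:
  "V \<in> vector_fields A \<Longrightarrow> X \<in> vector_fields A \<Longrightarrow> lie_endo A J V X \<in> vector_fields A"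
  unfolding lie_endo_def
  by (intro vector_fields_diff lie_bracket_vector_fields[unfolded fun_eq_iff] vector_fields_J)

lemma lie_endo_add:
  assumes "V \<in> vector_fields A" "X \<in> vector_fields A" "Y \<in> vector_fields A"
  shows "lie_endo A J V (\<lambda>q. X q + Y q) p = lie_endo A J V X p + lie_endo A J V Y p"
  using assms by (simp add: lie_endo_def J_simps lie_bracket_add_right vector_fields_J)

text \<open>
  A conformal map of oriented planes is complex linear: the cases \<open>Y = X\<close> and \<open>Y = JX\<close> below
  follow from the conformality assumption, and they span unless \<open>X\<close> vanishes at \<open>p\<close>. There,
  polarising the case \<open>Y = X\<close> replaces the tensoriality of \<open>lie_endo\<close>.
\<close>

lemma lie_endo_orthogonal:
  assumes E: "\<And>p. subspace (E p)" "\<And>p. dim (E p) = 2" "\<And>p u. u \<in> E p \<Longrightarrow> J p u \<in> E p"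
    and Z: "Z \<in> vector_fields A"
    and conf: "\<And>X Y. X \<in> sections A E \<Longrightarrow> Y \<in> sections A E \<Longrightarrow>
      lie_metric A g Z X Y p = a * g p (X p) (Y p)"
    and X: "X \<in> sections A E" and Y: "Y \<in> sections A E"
  shows "g p (lie_endo A J Z X p) (Y p) = 0"
proof -
  have JE: "(\<lambda>q. J q (X q)) \<in> sections A E" if "X \<in> sections A E" for X
    using that E(3) by (auto simp: sections_def vector_fields_J)
  \<comment> \<open>Apply conformality to the pair \<open>X\<close>, \<open>J X\<close>: both the
    differentiated function \<open>g(X, JX)\<close> and the right-hand side vanish, and moving
    \<open>J\<close> across \<open>g\<close> turns the two bracket terms into this product.\<close>
  have diag: "g p (lie_endo A J Z X p) (X p) = 0" if X: "X \<in> sections A E" for X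
    using conf[OF X JE[OF X]] g_sym[of p "X p" "lie_bracket A Z (\<lambda>q. J q (X q)) p"]
    by (simp add: lie_metric_def lie_endo_def g_J_self dir_deriv_const g_simps g_J_left)
  \<comment> \<open>Compare the pairs \<open>X\<close>, \<open>X\<close> and \<open>J X\<close>,
    \<open>J X\<close>. As \<open>J\<close> is isometric, the differentiated functions and the
    right-hand sides agree, hence so do \<open>g([Z,X], X)\<close> and
    \<open>g([Z,JX], JX)\<close>.\<close>
  have cross: "g p (lie_endo A J Z X p) (J p (X p)) = 0" if X: "X \<in> sections A E" for X
    using conf[OF X X] conf[OF JE[OF X] JE[OF X]]
      g_sym[of p "X p" "lie_bracket A Z X p"]
      g_sym[of p "J p (X p)" "lie_bracket A Z (\<lambda>q. J q (X q)) p"]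
    by (simp add: lie_metric_def lie_endo_def g_J_J g_simps)
  have skew: "g p (lie_endo A J Z X p) (Y p) = - g p (lie_endo A J Z Y p) (X p)"
  proof -
    have "(\<lambda>q. X q + Y q) \<in> sections A E"
      using X Y E(1) by (auto simp: sections_def vector_fields_add subspace_add)
    from diag[OF this] show ?thesis
      using X Y diag Z by (simp add: sections_def lie_endo_add g_simps)
  qed
  show ?thesis
  proof (cases "X p = 0")
    case True
    then show ?thesis using skew by (simp add: g_simps)
  next
    case False
    have "g p (X p) (X p) *\<^sub>R Y p = g p (Y p) (X p) *\<^sub>R X p + g p (Y p) (J p (X p)) *\<^sub>R J p (X p)"
      using X Y E by (intro complex_plane_expansion[of _ _ "E p"])
        (auto simp: sections_def g_bilinear g_pos g_J_J J_J intro: g_sym)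
    then have "g p (lie_endo A J Z X p) (g p (X p) (X p) *\<^sub>R Y p) = 0"
      using diag[OF X] cross[OF X] by (simp add: g_simps)
    then show ?thesis
      using False by (simp add: g_simps g_eq_0_iff)
  qed
qed

lemma sections_P: "X \<in> vector_fields A \<Longrightarrow> (\<lambda>q. P q (X q)) \<in> sections A D"
  by (simp add: sections_def vector_fields_P P_in_D)

lemma sections_perp: "X \<in> vector_fields A \<Longrightarrow> (\<lambda>q. X q - P q (X q)) \<in> sections A (perp g D)"
  by (simp add: sections_def vector_fields_P vector_fields_diff P_perp)

lemma sections_J:
  "X \<in> sections A D \<Longrightarrow> (\<lambda>q. J q (X q)) \<in> sections A D"
  "X \<in> sections A (perp g D) \<Longrightarrow> (\<lambda>q. J q (X q)) \<in> sections A (perp g D)"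
  by (simp_all add: sections_def vector_fields_J J_in_D J_in_perp)

lemma g_D_perp: "u \<in> D p \<Longrightarrow> v \<in> perp g D p \<Longrightarrow> g p u v = 0"
  using g_sym[of p u v] by (auto simp: perp_def)

section \<open>The opposite structure\<close>

definition I :: "'a \<Rightarrow> real^4 \<Rightarrow> real^4" where
  "I p u = J p (P p u) - J p (u - P p u)"

text \<open>A linear map is determined by its values on \<open>D p\<close> and on the complement,
  since \<open>P\<close> splits every vector into such parts; this makes the definite description
  well defined.\<close>

lemma opposite_structure_eq_I: "opposite_structure g J D p = I p"
  unfolding opposite_structure_def
proof (rule the_equality)
  show "linear (I p) \<and> (\<forall>v\<in>D p. I p v = J p v) \<and> (\<forall>v\<in>perp g D p. I p v = - J p v)"
    by (auto intro!: linearI simp: I_def P_D P_perp_eq_0 J_simps P_simps algebra_simps)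
  fix L assume L: "linear L \<and> (\<forall>v\<in>D p. L v = J p v) \<and> (\<forall>v\<in>perp g D p. L v = - J p v)"
  have "L u = I p u" for u
  proof -
    have "L u = L (P p u) + L (u - P p u)"
      using L linear_add[of L "P p u" "u - P p u"] by simp
    also have "\<dots> = J p (P p u) - J p (u - P p u)"
      using L P_in_D P_perp by simp
    finally show ?thesis
      by (simp add: I_def J_simps)
  qed
  then show "L = I p" by blast
qed

lemma I_I: "I p (I p u) = - u"
proof -
  have "P p (I p u) = J p (P p u)"
    by (simp add: I_def P_simps P_J P_P linear_0[OF J_linear])
  then have "I p (I p u) = J p (J p (P p u)) - J p (- J p (u - P p u))"
    by (simp add: I_def[of p "I p u"]) (simp add: I_def)
  also have "\<dots> = - P p u - (u - P p u)"
    by (simp only: J_J linear_neg[OF J_linear]) simp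
  finally show ?thesis by simp
qed

text \<open>\<open>I\<close> is \<open>J\<close> composed with the reflection that fixes
  \<open>D\<close> and negates its complement, and both factors are isometries.\<close>

lemma g_I_I: "g p (I p u) (I p v) = g p u v"
proof -
  let ?Q = "\<lambda>u. u - P p u"
  have orth: "g p (P p a) (?Q b) = 0" "g p (?Q b) (P p a) = 0" for a b
    using g_D_perp[OF P_in_D P_perp] g_sym[of p "?Q b" "P p a"] by simp_all
  have "g p (I p u) (I p v) = g p (P p u - ?Q u) (P p v - ?Q v)"
    by (simp add: I_def g_J_J flip: linear_diff[OF J_linear])
  also have "\<dots> = g p (P p u + ?Q u) (P p v + ?Q v)"
    unfolding bilinear_ladd[OF g_bilinear] bilinear_radd[OF g_bilinear]
      bilinear_lsub[OF g_bilinear, of _ "P p u" "?Q u"] bilinear_rsub[OF g_bilinear, of _ _ "P p v" "?Q v"]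
    by (simp add: orth)
  finally show ?thesis by simp
qed

lemma I_linear: "linear (I p)"
  by (intro linearI) (simp_all add: I_def J_simps P_simps algebra_simps)

lemma almost_hermitian_I: "almost_hermitian A g I"
proof -
  have "smooth_field_on A U (\<lambda>q. I q (X q))" if "open U" "smooth_field_on A U X" for U X
  proof -
    have diff: "smooth_field_on A U (\<lambda>q. X q - Y q)"
      if "smooth_field_on A U X" "smooth_field_on A U Y" for X Y
      using smooth_field_on_add[OF \<open>open U\<close> that(1)
          smooth_field_on_scaleR[OF \<open>open U\<close> smooth_fun_on_const[of U "-1"] that(2)]] by simp
    show ?thesis
      unfolding I_def using that by (intro diff smooth_field_on_J smooth_field_on_P)
  qed
  then show ?thesis
    unfolding almost_hermitian_def endomorphism_field_def
    using metric I_linear I_I g_I_I by blast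
qed

lemma vector_fields_I: "X \<in> vector_fields A \<Longrightarrow> (\<lambda>q. I q (X q)) \<in> vector_fields A"
  using almost_hermitian_I
  unfolding almost_hermitian_def endomorphism_field_def vector_fields_def by simp

lemmas I_add = linear_add[OF I_linear] and I_neg = linear_neg[OF I_linear]

lemma nijenhuis_I_add:
  assumes "X \<in> vector_fields A" "Y \<in> vector_fields A" "Z \<in> vector_fields A"
  shows "nijenhuis A I X (\<lambda>q. Y q + Z q) p = nijenhuis A I X Y p + nijenhuis A I X Z p"
  using assms
  by (simp add: nijenhuis_def I_add lie_bracket_add_right vector_fields_I)

lemma nijenhuis_I_skew: "nijenhuis A I X Y p = - nijenhuis A I Y X p"
  unfolding nijenhuis_def
  using lie_bracket_skew[of X Y p] lie_bracket_skew[of "\<lambda>q. I q (X q)" Y p]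
    lie_bracket_skew[of X "\<lambda>q. I q (Y q)" p] lie_bracket_skew[of "\<lambda>q. I q (X q)" "\<lambda>q. I q (Y q)" p]
  by (simp add: I_neg)

lemma sections_D_I: "X \<in> sections A D \<Longrightarrow> (\<lambda>q. I q (X q)) = (\<lambda>q. J q (X q))"
  by (auto simp: sections_def I_def P_D J_simps)

lemma sections_perp_I: "X \<in> sections A (perp g D) \<Longrightarrow> (\<lambda>q. I q (X q)) = (\<lambda>q. - J q (X q))"
  by (auto simp: sections_def I_def P_perp_eq_0 J_simps)

text \<open>
  On \<open>D\<^sup>\<bottom>\<close>, a complex line bundle, the projection of \<open>[X, Y]\<close> to \<open>D\<close> is tensorial and skew, hence
  invariant under \<open>J\<close>. Using \<open>|X|\<^sup>2 Y = g(Y, X) X + g(Y, JX) JX\<close>, whose coefficients are globally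
  smooth, avoids extending local frames.
\<close>

lemma P_lie_bracket_perp_J:
  assumes X: "X \<in> sections A (perp g D)" and Y: "Y \<in> sections A (perp g D)"
  shows "P p (lie_bracket A (\<lambda>q. J q (X q)) Y p + lie_bracket A X (\<lambda>q. J q (Y q)) p) = 0"
proof -
  define S where "S = (\<lambda>X Y. P p (lie_bracket A (\<lambda>q. J q (X q)) Y p + lie_bracket A X (\<lambda>q. J q (Y q)) p))"
  have nonzero: "S X Y = 0"
    if X: "X \<in> sections A (perp g D)" and Y: "Y \<in> sections A (perp g D)" and "X p \<noteq> 0" for X Y
  proof -
    have JX: "(\<lambda>q. J q (X q)) \<in> sections A (perp g D)"
      using X by (rule sections_J)
    have vf: "X \<in> vector_fields A" "Y \<in> vector_fields A" "(\<lambda>q. J q (X q)) \<in> vector_fields A"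
        "(\<lambda>q. J q (Y q)) \<in> vector_fields A"
      using X Y by (auto simp: sections_def vector_fields_J)
    \<comment> \<open>The derivatives of \<open>f\<close> enter only as coefficients of
      \<open>Z\<close> and \<open>J Z\<close>, which are orthogonal to \<open>D\<close> and killed
      by \<open>P\<close>.\<close>
    have scale: "S X (\<lambda>q. f q *\<^sub>R Z q) = f p *\<^sub>R S X Z"
      if "f \<in> smooth_funs A" "Z \<in> sections A (perp g D)" for f Z
    proof -
      have "Z \<in> vector_fields A" "P p (Z p) = 0" "P p (J p (Z p)) = 0"
        using that(2) J_in_perp by (auto simp: sections_def P_perp_eq_0)
      then show ?thesis
        using vf that(1)
        by (simp add: S_def J_simps lie_bracket_scaleR_right vector_fields_J P_simps algebra_simps)
    qed
    have add: "S X (\<lambda>q. Z q + W q) = S X Z + S X W"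
      if "Z \<in> vector_fields A" "W \<in> vector_fields A" for Z W
      using vf that
      by (simp add: S_def J_simps lie_bracket_add_right vector_fields_J P_simps)
    define a b n where "a = (\<lambda>q. g q (Y q) (X q))" and "b = (\<lambda>q. g q (Y q) (J q (X q)))"
      and "n = (\<lambda>q. g q (X q) (X q))"
    have smooth: "a \<in> smooth_funs A" "b \<in> smooth_funs A" "n \<in> smooth_funs A"
      unfolding a_def b_def n_def using vf by (auto intro: smooth_funs_g)
    have "n q *\<^sub>R Y q = a q *\<^sub>R X q + b q *\<^sub>R J q (X q)" for q
      unfolding a_def b_def n_def using X Y
      by (intro complex_plane_expansion[of _ _ "perp g D q"])
        (auto simp: sections_def g_bilinear g_pos g_J_J J_J subspace_perp dim_perp J_in_perp intro: g_sym)
    then have "n p *\<^sub>R S X Y = S X (\<lambda>q. a q *\<^sub>R X q + b q *\<^sub>R J q (X q))"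
      using scale[OF smooth(3) Y] by simp
    also have "\<dots> = a p *\<^sub>R S X X + b p *\<^sub>R S X (\<lambda>q. J q (X q))"
      using vf smooth by (simp add: add vector_fields_scaleR scale X JX)
    \<comment> \<open>On the frame \<open>X\<close>, \<open>J X\<close> the form vanishes:
      \<open>[JX, X] + [X, JX]\<close> cancels by skewness, and for \<open>J X\<close> in the second
      slot there remain \<open>[JX, JX]\<close> and \<open>[X, X]\<close>.\<close>
    also have "S X X = 0"
      using lie_bracket_skew[of X "\<lambda>q. J q (X q)" p] by (simp add: S_def P_simps)
    also have "S X (\<lambda>q. J q (X q)) = 0"
      using vf by (simp add: S_def J_J lie_bracket_uminus_right lie_bracket_self P_simps)
    finally show ?thesis
      using \<open>X p \<noteq> 0\<close> by (simp add: n_def g_eq_0_iff)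
  qed
  \<comment> \<open>This allows \<open>Y\<close> to take over as the frame field where
    \<open>X\<close> vanishes.\<close>
  have skew: "S X Y = - S Y X"
    using lie_bracket_skew[of X "\<lambda>q. J q (Y q)" p] lie_bracket_skew[of "\<lambda>q. J q (X q)" Y p]
    by (simp add: S_def P_simps)
  consider "X p \<noteq> 0" | "Y p \<noteq> 0" | "X p = 0" "Y p = 0"
    by blast
  then have "S X Y = 0"
  proof cases
    case 1
    then show ?thesis using X Y by (rule nonzero[rotated 2])
  next
    case 2
    then show ?thesis using nonzero[OF Y X] skew by simp
  next
    case 3
    then show ?thesis
      using X Y
      by (simp add: S_def sections_def vector_fields_J lie_bracket_eq_0_at_common_zero J_simps P_simps)
  qed
  then show ?thesis by (simp add: S_def)
qed

end

section \<open>Consequences of conformality and total geodesy\<close>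

locale conformal_geodesic_plane_field = complex_plane_field +
  assumes conformal: "conformal_foliation A g D"
    and geodesic: "totally_geodesic A nabla D"
begin

lemma D_involutive:
  assumes "V \<in> sections A D" "W \<in> sections A D"
  shows "lie_bracket A V W p \<in> D p"
proof -
  have "nabla V W p \<in> D p" "nabla W V p \<in> D p"
    using geodesic assms unfolding totally_geodesic_def sections_def by blast+
  then show ?thesis
    using assms by (simp add: sections_def lie_bracket_nabla subspace_diff subspace_D)
qed

text \<open>Through \<open>nabla\<close> the left side becomes
  \<open>g(\<nabla>V X, W) + g(V, \<nabla>W X)\<close>. Differentiating \<open>g(X, W) = 0\<close>
  along \<open>V\<close> trades the first term for \<open>- g(X, \<nabla>V W)\<close>, which is zero
  because \<open>\<nabla>V W\<close> stays in \<open>D\<close>; the second is symmetric.\<close>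

lemma lie_metric_perp_D:
  assumes X: "X \<in> sections A (perp g D)" and V: "V \<in> sections A D" and W: "W \<in> sections A D"
  shows "lie_metric A g X V W p = 0"
proof -
  have "g p (nabla V X p) (W p) = 0" if V: "V \<in> sections A D" and W: "W \<in> sections A D" for V W
  proof -
    have "g q (X q) (W q) = 0" for q
      using X W by (auto simp: sections_def perp_def)
    moreover have "g p (X p) (nabla V W p) = 0"
      using X V W geodesic by (auto simp: totally_geodesic_def sections_def perp_def)
    moreover have "X \<in> vector_fields A" "V \<in> vector_fields A" "W \<in> vector_fields A"
      using X V W by (auto simp: sections_def)
    ultimately show ?thesis
      using dir_deriv_metric[of V X W p] by (simp add: dir_deriv_const)
  qed
  from this[OF V W] this[OF W V] show ?thesis
    using X V W g_sym[of p "V p" "nabla W X p"]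
    by (simp add: sections_def lie_metric_def dir_deriv_metric lie_bracket_nabla g_simps)
qed

lemma lie_endo_perp_D:
  assumes X: "X \<in> sections A (perp g D)" and V: "V \<in> sections A D"
  shows "P p (lie_endo A J X V p) = 0"
proof -
  have vf: "X \<in> vector_fields A" "V \<in> vector_fields A"
    using X V by (auto simp: sections_def)
  \<comment> \<open>The section of \<open>D\<close> chosen for the test is the projection of
    \<open>lie_endo\<close> itself, so orthogonality to it forces its squared length to vanish. The
    conformal factor here is 0.\<close>
  have "(\<lambda>q. P q (lie_endo A J X V q)) \<in> sections A D"
    using vf by (intro sections_P) (simp add: lie_endo_vector_fields)
  from lie_endo_orthogonal[of D X p 0, OF subspace_D dim_D J_in_D vf(1) _ V this]
  have "g p (lie_endo A J X V p) (P p (lie_endo A J X V p)) = 0"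
    using lie_metric_perp_D[OF X] by simp
  then have "g p (P p (lie_endo A J X V p)) (P p (lie_endo A J X V p)) = 0"
    using g_D_perp[OF P_in_D P_perp, of p "lie_endo A J X V p" "lie_endo A J X V p"]
      g_sym[of p "lie_endo A J X V p"] by (simp add: g_simps)
  then show ?thesis by (simp add: g_eq_0_iff)
qed

text \<open>Split \<open>X\<close> along \<open>D\<close> and its complement. The first part stays
  in \<open>D\<close> because \<open>D\<close> is involutive and \<open>J\<close>-invariant; the
  second is where conformality enters, with factor \<open>\<alpha>(V)\<close>.\<close>

lemma lie_endo_D:
  assumes V: "V \<in> sections A D" and X: "X \<in> vector_fields A"
  shows "lie_endo A J V X p \<in> D p"
proof -
  have vfV: "V \<in> vector_fields A"
    using V by (simp add: sections_def)
  define X1 X2 where "X1 = (\<lambda>q. P q (X q))" and "X2 = (\<lambda>q. X q - P q (X q))"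
  have X1: "X1 \<in> sections A D" and X2: "X2 \<in> sections A (perp g D)"
    unfolding X1_def X2_def using X by (auto intro: sections_P sections_perp)
  have vf: "X1 \<in> vector_fields A" "X2 \<in> vector_fields A"
    using X1 X2 by (auto simp: sections_def)
  have "lie_endo A J V X1 p \<in> D p"
    unfolding lie_endo_def using V X1
    by (intro subspace_diff subspace_D J_in_D D_involutive sections_J)
  moreover have "lie_endo A J V X2 p \<in> D p"
  proof -
    let ?u = "lie_endo A J V X2"
    obtain \<alpha> where \<alpha>: "\<And>X Y. X \<in> vector_fields A \<Longrightarrow> Y \<in> vector_fields A \<Longrightarrow>
        X p \<in> perp g D p \<Longrightarrow> Y p \<in> perp g D p \<Longrightarrow> lie_metric A g V X Y p = \<alpha> p (V p) * g p (X p) (Y p)"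
      using conformal V unfolding conformal_foliation_def by metis
    \<comment> \<open>Again the component to be killed, now the one orthogonal to \<open>D\<close>,
      is used as the test section.\<close>
    have "(\<lambda>q. ?u q - P q (?u q)) \<in> sections A (perp g D)"
      using vf vfV by (intro sections_perp) (simp add: lie_endo_vector_fields)
    from lie_endo_orthogonal[of "perp g D" V p "\<alpha> p (V p)",
        OF subspace_perp dim_perp J_in_perp vfV _ X2 this]
    have "g p (?u p) (?u p - P p (?u p)) = 0"
      using \<alpha> by (simp add: sections_def)
    then have "g p (?u p - P p (?u p)) (?u p - P p (?u p)) = 0"
      using g_D_perp[OF P_in_D P_perp, of p "?u p" "?u p"] by (simp add: g_simps)
    then have "?u p = P p (?u p)"
      by (simp add: g_eq_0_iff)
    then show ?thesis using P_in_D by metis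
  qed
  moreover have "lie_endo A J V X p = lie_endo A J V X1 p + lie_endo A J V X2 p"
    using lie_endo_add[OF vfV vf, of p] by (simp add: X1_def X2_def)
  ultimately show ?thesis
    using subspace_add[OF subspace_D] by simp
qed

lemma holomorphic: "holomorphic_foliation A J D"
  unfolding holomorphic_foliation_def using lie_endo_D by blast

section \<open>Integrability of the opposite structure\<close>

lemma nijenhuis_I_D_perp:
  assumes V: "V \<in> sections A D" and X: "X \<in> sections A (perp g D)"
  shows "nijenhuis A I V X p = 0"
proof -
  let ?JV = "\<lambda>q. J q (V q)" and ?JX = "\<lambda>q. J q (X q)"
  have vf: "V \<in> vector_fields A" "X \<in> vector_fields A" "?JV \<in> vector_fields A" "?JX \<in> vector_fields A"
    using V X by (auto simp: sections_def vector_fields_J)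
  define a b c d where "a = lie_bracket A V X p" and "b = lie_bracket A ?JV X p"
    and "c = lie_bracket A V ?JX p" and "d = lie_bracket A ?JV ?JX p"
  \<comment> \<open>Holomorphy, for \<open>V\<close> and \<open>J V\<close>, fixes the components of
    \<open>c\<close> and \<open>d\<close> orthogonal to \<open>D\<close> in terms of
    \<open>a\<close> and \<open>b\<close>. The dual fact, for \<open>X\<close> and
    \<open>J X\<close>, fixes the components of \<open>b\<close> and \<open>d\<close> in
    \<open>D\<close> in terms of \<open>a\<close> and \<open>c\<close>.\<close>
  have "P p (c - J p a) = c - J p a" "P p (d - J p b) = d - J p b"
    using lie_endo_D[OF V vf(2), of p] lie_endo_D[OF sections_J(1)[OF V] vf(2), of p]
    by (simp_all add: P_D lie_endo_def a_def b_def c_def d_def)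
  moreover have "P p (b - J p a) = 0" "P p (d - J p c) = 0"
    using lie_endo_perp_D[OF X V, of p] lie_endo_perp_D[OF sections_J(2)[OF X] V, of p]
      lie_bracket_skew[of X V p] lie_bracket_skew[of X ?JV p]
      lie_bracket_skew[of ?JX V p] lie_bracket_skew[of ?JX ?JV p]
    by (simp_all add: lie_endo_def a_def b_def c_def d_def J_simps P_simps)
  ultimately have P: "c = J p a + P p c - J p (P p a)" "d = J p b + P p d - J p (P p b)"
      "P p b = J p (P p a)" "P p d = J p (P p c)"
    by (simp_all add: P_simps P_J algebra_simps)
  \<comment> \<open>Since \<open>I X = - J X\<close>, the terms with \<open>d\<close> and
    \<open>c\<close> change sign. After splitting \<open>I\<close> by \<open>P\<close>, the
    components in \<open>D\<close> and in its complement cancel separately.\<close>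
  have "nijenhuis A I V X p = - d - a - I p b + I p c"
    using vf by (simp add: nijenhuis_def sections_D_I[OF V] sections_perp_I[OF X]
        lie_bracket_uminus_right I_neg a_def b_def c_def d_def)
  also have "\<dots> = - d - a - (J p (P p b) - (J p b - J p (P p b))) + (J p (P p c) - (J p c - J p (P p c)))"
    by (simp add: I_def J_simps)
  also have "J p c = - a + J p (P p c) + P p a"
    using arg_cong[OF P(1), of "J p"] by (simp add: J_simps)
  also have "d = J p b + J p (P p c) + P p a"
    using P(2) by (simp add: P(3,4) J_simps)
  finally show ?thesis
    by (simp add: P(3) J_simps)
qed

lemma hermitian_I:
  assumes J: "integrable_structure A J"
  shows "hermitian A g I"
  unfolding hermitian_def integrable_structure_def
proof (intro conjI ballI allI almost_hermitian_I)
  fix X Y p assume XY: "X \<in> vector_fields A" "Y \<in> vector_fields A"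
  have N_J: "nijenhuis A J X Y p = 0" if "X \<in> vector_fields A" "Y \<in> vector_fields A" for X Y
    using J that unfolding integrable_structure_def by blast
  \<comment> \<open>All brackets involved remain in \<open>D\<close>, where \<open>I\<close> and
    \<open>J\<close> coincide.\<close>
  have DD: "nijenhuis A I V W p = 0" if V: "V \<in> sections A D" and W: "W \<in> sections A D" for V W
  proof -
    have "I p (lie_bracket A V W p) = J p (lie_bracket A V W p)"
      if "V \<in> sections A D" "W \<in> sections A D" for V W
      using D_involutive[OF that, of p] by (simp add: I_def P_D J_simps)
    then have "nijenhuis A I V W p = nijenhuis A J V W p"
      using V W by (simp add: nijenhuis_def sections_D_I sections_J)
    then show ?thesis using N_J V W by (simp add: sections_def)
  qed
  have HH: "nijenhuis A I X Y p = 0"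
    if X: "X \<in> sections A (perp g D)" and Y: "Y \<in> sections A (perp g D)" for X Y
  proof -
    let ?JX = "\<lambda>q. J q (X q)" and ?JY = "\<lambda>q. J q (Y q)"
    have vf: "X \<in> vector_fields A" "Y \<in> vector_fields A" "?JX \<in> vector_fields A" "?JY \<in> vector_fields A"
      using X Y by (auto simp: sections_def vector_fields_J)
    define s where "s = lie_bracket A ?JX Y p + lie_bracket A X ?JY p"
    have s: "P p s = 0"
      unfolding s_def using X Y by (rule P_lie_bracket_perp_J)
    \<comment> \<open>The two signs of \<open>I = - J\<close> cancel in the first bracket, while the
      mixed brackets contribute \<open>+ I s\<close>. As \<open>s\<close> is orthogonal to
      \<open>D\<close>, \<open>I s\<close> equals \<open>- J s\<close>, and the Nijenhuis expression
      of \<open>J\<close> reappears.\<close>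
    have "nijenhuis A I X Y p = lie_bracket A ?JX ?JY p - lie_bracket A X Y p + I p s"
      using vf vector_fields_uminus[OF vf(4)]
      by (simp add: nijenhuis_def sections_perp_I[OF X] sections_perp_I[OF Y] lie_bracket_uminus_right
          lie_bracket_uminus_left I_neg I_add s_def)
    also have "I p s = - J p s"
      using s by (simp add: I_def J_simps)
    also have "lie_bracket A ?JX ?JY p - lie_bracket A X Y p + - J p s = nijenhuis A J X Y p"
      by (simp add: nijenhuis_def s_def J_simps)
    finally show ?thesis
      using N_J[OF vf(1,2)] by simp
  qed
  have DH: "nijenhuis A I V X p = 0" "nijenhuis A I X V p = 0"
    if "V \<in> sections A D" "X \<in> sections A (perp g D)" for V X
    using nijenhuis_I_D_perp[OF that, of p] nijenhuis_I_skew[of X V p] by simp_all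
  define X1 X2 Y1 Y2 where "X1 = (\<lambda>q. P q (X q))" and "X2 = (\<lambda>q. X q - P q (X q))"
    and "Y1 = (\<lambda>q. P q (Y q))" and "Y2 = (\<lambda>q. Y q - P q (Y q))"
  have s: "X1 \<in> sections A D" "Y1 \<in> sections A D"
      "X2 \<in> sections A (perp g D)" "Y2 \<in> sections A (perp g D)"
    unfolding X1_def X2_def Y1_def Y2_def using XY by (auto intro: sections_P sections_perp)
  then have vf: "X1 \<in> vector_fields A" "X2 \<in> vector_fields A" "Y1 \<in> vector_fields A" "Y2 \<in> vector_fields A"
    by (auto simp: sections_def)
  have "nijenhuis A I Z Y p = nijenhuis A I Z Y1 p + nijenhuis A I Z Y2 p" if "Z \<in> vector_fields A" for Z
    using nijenhuis_I_add[OF that vf(3,4), of p] by (simp add: Y1_def Y2_def)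
  \<comment> \<open>Additivity in the first argument is obtained from that in the second by
    skewness.\<close>
  moreover have "nijenhuis A I X Y p = nijenhuis A I X1 Y p + nijenhuis A I X2 Y p"
    using nijenhuis_I_add[OF XY(2) vf(1,2), of p] nijenhuis_I_skew[of _ Y p]
    by (simp add: X1_def X2_def)
  ultimately show "nijenhuis A I X Y p = 0"
    using vf s by (simp add: DD HH DH)
qed

end

theorem corollary2:
  fixes A :: "('a::{t2_space, second_countable_topology}, real^4) chart set"
    and g :: "'a \<Rightarrow> real^4 \<Rightarrow> real^4 \<Rightarrow> real"
    and J :: "'a \<Rightarrow> real^4 \<Rightarrow> real^4"
    and nabla :: "('a \<Rightarrow> real^4) \<Rightarrow> ('a \<Rightarrow> real^4) \<Rightarrow> 'a \<Rightarrow> real^4"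
    and D :: "'a \<Rightarrow> (real^4) set"
  assumes "kaehler_surface A g J"
    and "levi_civita A g nabla"
    and "foliation A 2 D"
    and "complex_distribution J D"
    and "conformal_foliation A g D"
    and "totally_geodesic A nabla D"
  shows "hermitian A g (opposite_structure g J D) \<and> holomorphic_foliation A J D"
proof -
  have k: "smooth_atlas A" "almost_hermitian A g J" "integrable_structure A J"
    using assms(1) unfolding kaehler_surface_def kaehler_def hermitian_def by blast+
  have "riemannian_metric A g" "smooth_distribution A 2 D"
    using k(2) assms(3) unfolding almost_hermitian_def foliation_def by blast+
  then interpret conformal_geodesic_plane_field A g nabla J D
    using k assms by unfold_locales
  have "opposite_structure g J D = I"
    using opposite_structure_eq_I by blast
  then show ?thesis
    using hermitian_I[OF k(3)] holomorphic by simp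
qed

end
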